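(* Let $(\Gamma,\alpha)$ be a $d$-valent abstract one-skeleton which is 3-independent and non-cyclic. Let $\xi\in\mathcal P$ be a polarizing vector for which a $\xi$-compatible function $\phi:V_\Gamma\to\mathbb R$ exists, and let $\sigma(p)$ denote the index of $p$ with respect to $\xi$. Suppose that for every $p\in V_\Gamma$ an element $\tau_p\in H^{2\sigma(p)}(\Gamma,\alpha)$ is given such that $\tau_p$ is supported on $F_p$ and $\tau_p(p)=\prod_{e\in E_p,\ \alpha_e(\xi)<0}\alpha_e$. Then for every $m\ge0$ $$H^{2m}(\Gamma,\alpha)=\bigoplus_{\sigma(p)\le m}\mathbb S^{m-\sigma(p)}(\mathfrak g^* )\,\tau_p .$$ In particular, $H(\Gamma,\alpha)$ is a free $\mathbb S(\mathfrak g^* )$-module with the $\tau_p$'s, $p\in V_\Gamma$, as (free) generators.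
   Context: $\mathfrak g$ is an $n$-dimensional real vector space, $\mathfrak g^*$ its dual, $\mathbb S(\mathfrak g^* )=\bigoplus_k\mathbb S^k(\mathfrak g^* )$ the symmetric algebra (polynomial functions on $\mathfrak g$). Abstract one-skeleton: a finite $d$-valent graph $\Gamma$ (multiple edges allowed) with vertex set $V_\Gamma$ and set $E_\Gamma$ of oriented edges (each edge occurs with both orientations; $i(e),t(e)$ are the initial and terminal vertices of $e$, $\bar e$ is $e$ reversed, $E_p=\{e: i(e)=p\}$ has $d$ elements), a connection $\theta$, i.e. bijections $\theta_e:E_{i(e)}\to E_{t(e)}$ with $\theta_{\bar e}=\theta_e^{-1}$, and an axial function $\alpha:E_\Gamma\to\mathfrak g^*$ such that: (A1) for every $p$ the vectors $\alpha_e$, $e\in E_p$, are pairwise linearly independent; (A2) for every $e$ there are positive numbers $m_e,m_{\bar e}$ with $m_{\bar e}\alpha_{\bar e}=-m_e\alpha_e$; (A3) for every $e\in E_\Gamma$ and $e_i\in E_{i(e)}$, $\alpha_{\theta_e(e_i)}=\lambda_{i,e}\alpha_{e_i}+c_{i,e}\alpha_e$ with $\lambda_{i,e}>0$, $c_{i,e}\in\mathbb R$. 3-independent: for every vertex $p$ and any three distinct edges in $E_p$, the three values of $\alpha$ are linearly independent. Polarizing vectors: $\mathcal P=\{\xi\in\mathfrak g:\alpha_e(\xi)\ne0\ \forall e\in E_\Gamma\}$. For $\xi\in\mathcal P$ the index of a vertex $p$ is the number of $e\in E_p$ with $\alpha_e(\xi)<0$; $b_{2i}(\Gamma)$ is the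 number of vertices of index $i$; this is independent of $\xi\in\mathcal P$. The same definitions apply to a connected component of a subgraph $\Gamma_{\mathfrak h}$ (below) using its own edges. A function $\phi:V_\Gamma\to\mathbb R$ is $\xi$-compatible if $\phi(t(e))>\phi(i(e))$ for every $e\in E_\Gamma$ with $\alpha_e(\xi)>0$. The flow-out $F_p$ is the set of vertices (including $p$) that can be reached from $p$ by a path of oriented edges $e$ with $\alpha_e(\xi)>0$. For a subspace $\mathfrak h\subset\mathfrak g$, $\Gamma_{\mathfrak h}$ is the subgraph whose edges are those $e$ with $\alpha_e\in\mathfrak h^\perp$ (annihilator of $\mathfrak h$). Non-cyclic: (NCA1) for some $\xi\in\mathcal P$, the graph $\Gamma$ with each edge oriented so that $\alpha_e(\xi)>0$ has no oriented cycles; (NCA2) for every codimension 2 subspace $\mathfrak h$ of $\mathfrak g$, every connected component $\Gamma_0$ of $\Gamma_{\mathfrak h}$ has $b_0(\Gamma_0)=1$. Cohomology ring: $H(\Gamma,\alpha)$ is the ring of maps $f:V_\Gamma\to\mathbb S(\mathfrak g^* )$ such that $f(i(e))-f(t(e))\in\alpha_e\,\mathbb S(\mathfrak g^* )$ for every $e\in E_\Gamma$, an $\mathbb S(\mathfrak g^* )$-module by pointwise multiplication; $H^{2m}(\Gamma,\alpha)$ is the subspace of those $f$ with values in $\mathbb S^m(\mathfrak g^* )$. *)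

theory Defs
  imports Complex_Main
    "HOL-Library.FuncSet"
    "HOL-Library.Function_Algebras"
    "Graph_Theory.Graph_Theory"
begin

section \<open>The symmetric algebra of the dual space\<close>

text \<open>
  The vector space \<open>\<gg>\<close> is a type \<open>'g :: real_vector\<close> (finite-dimensionality is an axiom of
  the one-skeleton below), and the dual space consists of the functions \<open>f :: 'g \<Rightarrow> real\<close> with
  \<^term>\<open>linear f\<close>. The symmetric algebra of the dual is realised as the algebra of polynomial
  functions on \<open>'g\<close>; products of functions are the pointwise ones of
  \<^theory>\<open>HOL-Library.Function_Algebras\<close>.
\<close>

text \<open>The \<open>k\<close>-th symmetric power: the real span of all products of \<open>k\<close> linear forms.\<close>

definition sym_power :: "nat \<Rightarrow> ('g::real_vector \<Rightarrow> real) set" where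
  "sym_power k =
     {f. \<exists>(N::nat) (c :: nat \<Rightarrow> real) (l :: nat \<Rightarrow> nat \<Rightarrow> 'g \<Rightarrow> real).
           (\<forall>i<N. \<forall>j<k. linear (l i j)) \<and> f = (\<lambda>x. \<Sum>i<N. c i * (\<Prod>j<k. l i j x))}"

definition sym_alg :: "('g::real_vector \<Rightarrow> real) set" where
  "sym_alg =
     {f. \<exists>(N::nat) (g :: nat \<Rightarrow> 'g \<Rightarrow> real). (\<forall>k\<le>N. g k \<in> sym_power k) \<and> f = (\<Sum>k\<le>N. g k)}"

text \<open>Linear independence, in the dual space, of the family \<open>\<alpha>\<close> restricted to a finite index set.\<close>

definition indep_forms :: "('e \<Rightarrow> 'g \<Rightarrow> real) \<Rightarrow> 'e set \<Rightarrow> bool" where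
  "indep_forms \<alpha> A \<longleftrightarrow>
     (\<forall>c :: 'e \<Rightarrow> real. (\<forall>x. (\<Sum>e\<in>A. c e * \<alpha> e x) = 0) \<longrightarrow> (\<forall>e\<in>A. c e = 0))"


section \<open>Abstract one-skeleta\<close>

text \<open>
  The arcs of the digraph \<open>G\<close> are the oriented edges; the initial and terminal vertices of an
  arc are its tail and head, and \<open>arev\<close> reverses the orientation.
\<close>

locale one_skeleton = fin_digraph G + bidirected_digraph G arev
  for G :: "('v, 'e) pre_digraph" (structure) and arev :: "'e \<Rightarrow> 'e" +
  fixes \<theta> :: "'e \<Rightarrow> 'e \<Rightarrow> 'e"
    and \<alpha> :: "'e \<Rightarrow> 'g::real_vector \<Rightarrow> real"
    and d :: nat
  assumes finite_dim: "\<exists>B :: 'g set. finite B \<and> span B = UNIV"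
    and valent: "p \<in> verts G \<Longrightarrow> card (out_arcs G p) = d"
    and connection_bij:
      "e \<in> arcs G \<Longrightarrow> bij_betw (\<theta> e) (out_arcs G (tail G e)) (out_arcs G (head G e))"
    and connection_arev:
      "\<lbrakk>e \<in> arcs G; e' \<in> out_arcs G (tail G e)\<rbrakk> \<Longrightarrow> \<theta> (arev e) (\<theta> e e') = e'"
    and axial_linear: "e \<in> arcs G \<Longrightarrow> linear (\<alpha> e)"
    and axial_indep:
      "\<lbrakk>p \<in> verts G; e1 \<in> out_arcs G p; e2 \<in> out_arcs G p; e1 \<noteq> e2\<rbrakk> \<Longrightarrow> indep_forms \<alpha> {e1, e2}"
    and axial_arev:
      "e \<in> arcs G \<Longrightarrow> \<exists>m m' :: real. m > 0 \<and> m' > 0 \<and> (\<forall>x. m' * \<alpha> (arev e) x = - m * \<alpha> e x)"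
    and axial_connection:
      "\<lbrakk>e \<in> arcs G; e' \<in> out_arcs G (tail G e)\<rbrakk> \<Longrightarrow>
         \<exists>l c :: real. l > 0 \<and> (\<forall>x. \<alpha> (\<theta> e e') x = l * \<alpha> e' x + c * \<alpha> e x)"

definition three_independent :: "('v, 'e) pre_digraph \<Rightarrow> ('e \<Rightarrow> 'g::real_vector \<Rightarrow> real) \<Rightarrow> bool" where
  "three_independent G \<alpha> \<longleftrightarrow>
     (\<forall>p\<in>verts G. \<forall>e1\<in>out_arcs G p. \<forall>e2\<in>out_arcs G p. \<forall>e3\<in>out_arcs G p.
        e1 \<noteq> e2 \<longrightarrow> e1 \<noteq> e3 \<longrightarrow> e2 \<noteq> e3 \<longrightarrow> indep_forms \<alpha> {e1, e2, e3})"

definition polarizing :: "('v, 'e) pre_digraph \<Rightarrow> ('e \<Rightarrow> 'g::real_vector \<Rightarrow> real) \<Rightarrow> 'g set" where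
  "polarizing G \<alpha> = {\<xi>. \<forall>e\<in>arcs G. \<alpha> e \<xi> \<noteq> 0}"

definition descending_arcs ::
    "('v, 'e) pre_digraph \<Rightarrow> ('e \<Rightarrow> 'g::real_vector \<Rightarrow> real) \<Rightarrow> 'g \<Rightarrow> 'v \<Rightarrow> 'e set" where
  "descending_arcs G \<alpha> \<xi> p = {e \<in> out_arcs G p. \<alpha> e \<xi> < 0}"

definition vertex_index ::
    "('v, 'e) pre_digraph \<Rightarrow> ('e \<Rightarrow> 'g::real_vector \<Rightarrow> real) \<Rightarrow> 'g \<Rightarrow> 'v \<Rightarrow> nat" where
  "vertex_index G \<alpha> \<xi> p = card (descending_arcs G \<alpha> \<xi> p)"

text \<open>
  \<open>betti G \<alpha> i\<close> is the number \<open>b\<^sub>2\<^sub>i\<close> of vertices of index \<open>i\<close>. It does not depend on the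
  polarizing vector, hence the definite description.
\<close>

definition betti :: "('v, 'e) pre_digraph \<Rightarrow> ('e \<Rightarrow> 'g::real_vector \<Rightarrow> real) \<Rightarrow> nat \<Rightarrow> nat" where
  "betti G \<alpha> i =
     (THE b. \<forall>\<xi>\<in>polarizing G \<alpha>. b = card {p \<in> verts G. vertex_index G \<alpha> \<xi> p = i})"

definition compatible_function ::
    "('v, 'e) pre_digraph \<Rightarrow> ('e \<Rightarrow> 'g::real_vector \<Rightarrow> real) \<Rightarrow> 'g \<Rightarrow> ('v \<Rightarrow> real) \<Rightarrow> bool" where
  "compatible_function G \<alpha> \<xi> \<phi> \<longleftrightarrow> (\<forall>e\<in>arcs G. \<alpha> e \<xi> > 0 \<longrightarrow> \<phi> (head G e) > \<phi> (tail G e))"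

definition ascending_graph ::
    "('v, 'e) pre_digraph \<Rightarrow> ('e \<Rightarrow> 'g::real_vector \<Rightarrow> real) \<Rightarrow> 'g \<Rightarrow> ('v, 'e) pre_digraph" where
  "ascending_graph G \<alpha> \<xi> = G\<lparr>arcs := {e \<in> arcs G. \<alpha> e \<xi> > 0}\<rparr>"

definition flow_out ::
    "('v, 'e) pre_digraph \<Rightarrow> ('e \<Rightarrow> 'g::real_vector \<Rightarrow> real) \<Rightarrow> 'g \<Rightarrow> 'v \<Rightarrow> 'v set" where
  "flow_out G \<alpha> \<xi> p = {q. p \<rightarrow>\<^sup>*\<^bsub>ascending_graph G \<alpha> \<xi>\<^esub> q}"

definition annihilated_subgraph ::
    "('v, 'e) pre_digraph \<Rightarrow> ('e \<Rightarrow> 'g::real_vector \<Rightarrow> real) \<Rightarrow> 'g set \<Rightarrow> ('v, 'e) pre_digraph" where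
  "annihilated_subgraph G \<alpha> \<hh> = G\<lparr>arcs := {e \<in> arcs G. \<forall>x\<in>\<hh>. \<alpha> e x = 0}\<rparr>"

text \<open>
  Every edge of a one-skeleton occurs with both orientations, also in \<open>annihilated_subgraph\<close>,
  so the connected components are the strongly connected components of the digraph.
\<close>

definition non_cyclic :: "('v, 'e) pre_digraph \<Rightarrow> ('e \<Rightarrow> 'g::real_vector \<Rightarrow> real) \<Rightarrow> bool" where
  "non_cyclic G \<alpha> \<longleftrightarrow>
     (\<exists>\<xi>\<in>polarizing G \<alpha>. \<not> (\<exists>c. pre_digraph.cycle (ascending_graph G \<alpha> \<xi>) c)) \<and>
     (\<forall>\<hh>. subspace \<hh> \<and> dim \<hh> + 2 = dim (UNIV :: 'g set) \<longrightarrow>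
        (\<forall>G0 \<in> pre_digraph.sccs (annihilated_subgraph G \<alpha> \<hh>). betti G0 \<alpha> 0 = 1))"


section \<open>The cohomology ring\<close>

text \<open>
  Maps from the vertex set to the symmetric algebra are represented by total functions that
  vanish outside of the vertex set.
\<close>

definition cohomology ::
    "('v, 'e) pre_digraph \<Rightarrow> ('e \<Rightarrow> 'g::real_vector \<Rightarrow> real) \<Rightarrow> ('v \<Rightarrow> 'g \<Rightarrow> real) set" where
  "cohomology G \<alpha> =
     {f. (\<forall>p\<in>verts G. f p \<in> sym_alg) \<and> (\<forall>p. p \<notin> verts G \<longrightarrow> f p = 0) \<and>
         (\<forall>e\<in>arcs G. \<exists>h\<in>sym_alg. f (tail G e) - f (head G e) = \<alpha> e * h)}"

text \<open>\<open>cohomology_deg G \<alpha> m\<close> is the graded piece of degree \<open>2m\<close>.\<close>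

definition cohomology_deg ::
    "('v, 'e) pre_digraph \<Rightarrow> ('e \<Rightarrow> 'g::real_vector \<Rightarrow> real) \<Rightarrow> nat \<Rightarrow> ('v \<Rightarrow> 'g \<Rightarrow> real) set" where
  "cohomology_deg G \<alpha> m = {f \<in> cohomology G \<alpha>. \<forall>p\<in>verts G. f p \<in> sym_power m}"

definition smult_coh ::
    "('g \<Rightarrow> real) \<Rightarrow> ('v \<Rightarrow> 'g \<Rightarrow> real) \<Rightarrow> 'v \<Rightarrow> 'g \<Rightarrow> real" (infixr \<open>\<odot>\<close> 75) where
  "s \<odot> f = (\<lambda>v. s * f v)"

text \<open>
  \<open>M\<close> is the internal direct sum of the finite family of additive subgroups \<open>W i\<close>: every element
  of \<open>M\<close> is a sum of elements \<open>u i \<in> W i\<close> for exactly one family \<open>u\<close>, and all these sums lie in \<open>M\<close>.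
\<close>

definition is_direct_sum :: "'m::ab_group_add set \<Rightarrow> 'i set \<Rightarrow> ('i \<Rightarrow> 'm set) \<Rightarrow> bool" where
  "is_direct_sum M I W \<longleftrightarrow> finite I \<and> bij_betw (\<lambda>u. \<Sum>i\<in>I. u i) (\<Pi>\<^sub>E i\<in>I. W i) M"

text \<open>
  \<open>M\<close> is a module over the ring \<open>S\<close> of functions, and it is free with the finite family
  \<open>b i\<close>, \<open>i \<in> I\<close>, as a basis.
\<close>

definition is_free_module ::
    "('g \<Rightarrow> real) set \<Rightarrow> ('v \<Rightarrow> 'g \<Rightarrow> real) set \<Rightarrow> 'i set \<Rightarrow> ('i \<Rightarrow> 'v \<Rightarrow> 'g \<Rightarrow> real) \<Rightarrow> bool" where
  "is_free_module S M I b \<longleftrightarrow>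
     0 \<in> M \<and> (\<forall>f\<in>M. \<forall>g\<in>M. f + g \<in> M) \<and> (\<forall>s\<in>S. \<forall>f\<in>M. s \<odot> f \<in> M) \<and>
     finite I \<and> (\<forall>i\<in>I. b i \<in> M) \<and>
     bij_betw (\<lambda>h. \<Sum>i\<in>I. h i \<odot> b i) (I \<rightarrow>\<^sub>E S) M"

end

theory Submission
  imports Defs
begin

text \<open>
  Let \<open>f\<close> be a class vanishing outside an upward closed set \<open>A\<close> of vertices, and let \<open>p \<in> A\<close> minimise \<open>\<phi>\<close>.
  The edges descending from \<open>p\<close> leave \<open>A\<close>, so \<open>f p\<close> is divisible by their pairwise independent
  linear forms, hence by their product \<open>\<tau> p p\<close>. Subtracting the corresponding multiple of
  \<open>\<tau> p\<close> gives a class vanishing outside \<open>A - {p}\<close>, and induction shows that the \<open>\<tau> p\<close> span.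
  They are independent because the family is triangular with respect to \<open>\<phi>\<close>.
\<close>

section \<open>Polynomial functions\<close>

lemma sum_fun_apply: "(\<Sum>i\<in>A. f i) x = (\<Sum>i\<in>A. f i x)"
  by (induction A rule: infinite_finite_induct) auto

section \<open>Homogeneous polynomial functions: sums, products and an induction principle\<close>

lemma sym_power_zero: "0 \<in> sym_power k"
  unfolding sym_power_def by (auto intro!: exI[of _ "0::nat"] simp: zero_fun_def)

lemma sym_power_const: "(\<lambda>x. c) \<in> sym_power 0"
  unfolding sym_power_def by (auto intro!: exI[of _ "1::nat"] exI[of _ "\<lambda>_. c"])

lemma sym_power_add:
  assumes "f \<in> sym_power k" "g \<in> sym_power k"
  shows "f + g \<in> sym_power k"
proof -
  obtain N c l where f: "\<And>i j. \<lbrakk>i < N; j < k\<rbrakk> \<Longrightarrow> linear (l i j)"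
      "f = (\<lambda>x. \<Sum>i<N::nat. c i * (\<Prod>j<k. l i j x))"
    using assms(1) unfolding sym_power_def by blast
  obtain N' c' l' where g: "\<And>i j. \<lbrakk>i < N'; j < k\<rbrakk> \<Longrightarrow> linear (l' i j)"
      "g = (\<lambda>x. \<Sum>i<N'::nat. c' i * (\<Prod>j<k. l' i j x))"
    using assms(2) unfolding sym_power_def by blast
  define C where "C i = (if i < N then c i else c' (i - N))" for i
  define L where "L i = (if i < N then l i else l' (i - N))" for i
  have "(f + g) x = (\<Sum>i<N + N'. C i * (\<Prod>j<k. L i j x))" for x
  proof -
    \<comment> \<open>Stated for every \<open>M\<close> so that induction applies. Truncated
      subtraction keeps the second sum empty as long as \<open>M\<close> does not exceed
      \<open>N\<close>.\<close>
    have "(\<Sum>i<M. C i * (\<Prod>j<k. L i j x)) =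
        (\<Sum>i<min M N. c i * (\<Prod>j<k. l i j x)) + (\<Sum>i<M - N. c' i * (\<Prod>j<k. l' i j x))" for M
      by (induction M) (auto simp: C_def L_def min_def Suc_diff_le not_less le_antisym)
    from this[of "N + N'"] show ?thesis
      by (simp add: f(2) g(2))
  qed
  moreover have "linear (L i j)" if "i < N + N'" "j < k" for i j
    using that f(1) g(1) by (auto simp: L_def)
  ultimately show ?thesis
    unfolding sym_power_def by (auto intro!: exI[of _ "N + N'"] exI[of _ C] exI[of _ L] simp: fun_eq_iff)
qed

lemma sym_power_linear_mult:
  assumes "linear a" "f \<in> sym_power k"
  shows "a * f \<in> sym_power (Suc k)"
proof -
  obtain N c l where f: "\<And>i j. \<lbrakk>i < N; j < k\<rbrakk> \<Longrightarrow> linear (l i j)"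
      "f = (\<lambda>x. \<Sum>i<N::nat. c i * (\<Prod>j<k. l i j x))"
    using assms(2) unfolding sym_power_def by blast
  \<comment> \<open>The form \<open>a\<close> becomes the last factor, at position \<open>k\<close>,
    of every product.\<close>
  define L where "L i = (l i)(k := a)" for i
  have "(a * f) x = (\<Sum>i<N. c i * (\<Prod>j<Suc k. L i j x))" for x
    by (simp add: f(2) L_def sum_distrib_left mult_ac)
  moreover have "linear (L i j)" if "i < N" "j < Suc k" for i j
    using that f(1) assms(1) by (auto simp: L_def)
  ultimately show ?thesis
    unfolding sym_power_def by (auto intro!: exI[of _ N] exI[of _ c] exI[of _ L] simp: fun_eq_iff)
qed

text \<open>Every element is a finite sum of scaled products, and each such product arises from a
  constant by multiplying by one linear form at a time. The case \<open>zero\<close> is required in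
  every degree because the sum may be empty.\<close>

lemma sym_power_induct [consumes 1, case_names zero const add mult]:
  assumes "f \<in> sym_power k"
    and zero: "\<And>k. P k 0"
    and const: "\<And>c. P 0 (\<lambda>x. c)"
    and add: "\<And>k f g. \<lbrakk>f \<in> sym_power k; g \<in> sym_power k; P k f; P k g\<rbrakk> \<Longrightarrow> P k (f + g)"
    and mult: "\<And>k a f. \<lbrakk>linear a; f \<in> sym_power k; P k f\<rbrakk> \<Longrightarrow> P (Suc k) (a * f)"
  shows "P k f"
proof -
  have prod: "(\<lambda>x. c * (\<Prod>j<k. l j x)) \<in> sym_power k \<and> P k (\<lambda>x. c * (\<Prod>j<k. l j x))"
    if "\<And>j. j < k \<Longrightarrow> linear (l j)" for c l k
    using that
  proof (induction k)
    case 0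
    then show ?case using const sym_power_const by simp
  next
    case (Suc k)
    have eq: "(\<lambda>x. c * (\<Prod>j<Suc k. l j x)) = l k * (\<lambda>x. c * (\<Prod>j<k. l j x))"
      by (simp add: fun_eq_iff mult_ac)
    show ?case
      unfolding eq using Suc by (auto intro: mult sym_power_linear_mult)
  qed
  obtain N c l where f: "\<And>i j. \<lbrakk>i < N; j < k\<rbrakk> \<Longrightarrow> linear (l i j)"
      "f = (\<lambda>x. \<Sum>i<N::nat. c i * (\<Prod>j<k. l i j x))"
    using assms(1) unfolding sym_power_def by blast
  have "(\<Sum>i<M. (\<lambda>x. c i * (\<Prod>j<k. l i j x))) \<in> sym_power k \<and> P k (\<Sum>i<M. (\<lambda>x. c i * (\<Prod>j<k. l i j x)))"
    if "M \<le> N" for M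
    using that
  proof (induction M)
    case 0
    then show ?case by (simp only: lessThan_0 sum.empty zero sym_power_zero simp_thms)
  next
    case (Suc M)
    then have "(\<lambda>x. c M * (\<Prod>j<k. l M j x)) \<in> sym_power k \<and> P k (\<lambda>x. c M * (\<Prod>j<k. l M j x))"
      by (intro prod f(1)) auto
    moreover have "(\<Sum>i<M. (\<lambda>x. c i * (\<Prod>j<k. l i j x))) \<in> sym_power k \<and>
        P k (\<Sum>i<M. (\<lambda>x. c i * (\<Prod>j<k. l i j x)))"
      using Suc by simp
    ultimately show ?case
      unfolding sum.lessThan_Suc by (blast intro: add sym_power_add)
  qed
  moreover have "f = (\<Sum>i<N. (\<lambda>x. c i * (\<Prod>j<k. l i j x)))"
    by (simp add: fun_eq_iff f(2) sum_fun_apply)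
  ultimately show ?thesis by auto
qed

lemma sym_power_scale: "f \<in> sym_power k \<Longrightarrow> (\<lambda>x. c) * f \<in> sym_power k"
proof (induction rule: sym_power_induct)
  case (zero k)
  then show ?case by (simp only: mult_zero_right sym_power_zero)
next
  case (const k')
  then show ?case using sym_power_const[of "c * k'"] by (simp add: times_fun_def)
next
  case (add k f g)
  then show ?case using sym_power_add[OF add(3,4)] by (simp only: distrib_left)
next
  case (mult k a f)
  then show ?case using sym_power_linear_mult[OF mult(1,3)] by (simp only: mult.left_commute)
qed

lemma sym_power_mult:
  assumes "f \<in> sym_power k" "g \<in> sym_power m"
  shows "f * g \<in> sym_power (k + m)"
  using assms(1)
proof (induction rule: sym_power_induct)
  case (zero k)
  then show ?case by (simp only: mult_zero_left sym_power_zero)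
next
  case (const c)
  then show ?case using sym_power_scale[OF assms(2)] by (simp only: add_0)
next
  case (add k u v)
  then show ?case using sym_power_add[OF add(3,4)] by (simp only: distrib_right)
next
  case (mult k a u)
  then show ?case using sym_power_linear_mult[OF mult(1,3)] by (simp only: mult.assoc add_Suc)
qed

text \<open>Reduces closure under differences to closure under sums and constant multiples.\<close>

lemma diff_eq_add_const_mult: "f - g = f + (\<lambda>x. - 1) * g" for f g :: "'a \<Rightarrow> real"
  by (rule ext) simp

lemma sym_power_diff: "\<lbrakk>f \<in> sym_power k; g \<in> sym_power k\<rbrakk> \<Longrightarrow> f - g \<in> sym_power k"
  by (subst diff_eq_add_const_mult) (rule sym_power_add[OF _ sym_power_scale])

section \<open>Inhomogeneous polynomial functions\<close>

lemma sym_power_sym_alg: "f \<in> sym_power k \<Longrightarrow> f \<in> sym_alg"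
  unfolding sym_alg_def
  by (auto intro!: exI[of _ k] exI[of _ "\<lambda>i. if i = k then f else 0"] simp: sym_power_zero)

lemma sym_alg_add:
  assumes "f \<in> sym_alg" "g \<in> sym_alg"
  shows "f + g \<in> sym_alg"
proof -
  obtain N u where f: "\<And>k. k \<le> N \<Longrightarrow> u k \<in> sym_power k" "f = (\<Sum>k\<le>N::nat. u k)"
    using assms(1) unfolding sym_alg_def by blast
  obtain N' u' where g: "\<And>k. k \<le> N' \<Longrightarrow> u' k \<in> sym_power k" "g = (\<Sum>k\<le>N'::nat. u' k)"
    using assms(2) unfolding sym_alg_def by blast
  \<comment> \<open>Both families of homogeneous parts are padded by 0 so that they can be added up
    to the larger of the two degrees.\<close>
  define w where "w k = (if k \<le> N then u k else 0) + (if k \<le> N' then u' k else 0)" for k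
  have "w k \<in> sym_power k" for k
    unfolding w_def using f(1) g(1) by (intro sym_power_add) (auto simp: sym_power_zero)
  moreover have "f + g = (\<Sum>k\<le>max N N'. w k)"
    unfolding w_def sum.distrib f(2) g(2)
    by (intro arg_cong2[of _ _ _ _ "(+)"] sum.mono_neutral_cong_left) auto
  ultimately show ?thesis
    unfolding sym_alg_def by blast
qed

lemma sym_alg_zero: "0 \<in> sym_alg"
  by (rule sym_power_sym_alg[OF sym_power_zero[of 0]])

lemma sym_alg_induct [consumes 1, case_names power add]:
  assumes "f \<in> sym_alg"
    and power: "\<And>k f. f \<in> sym_power k \<Longrightarrow> P f"
    and add: "\<And>f g. \<lbrakk>f \<in> sym_alg; g \<in> sym_alg; P f; P g\<rbrakk> \<Longrightarrow> P (f + g)"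
  shows "P f"
proof -
  obtain N u where f: "\<And>k. k \<le> N \<Longrightarrow> u k \<in> sym_power k" "f = (\<Sum>k\<le>N::nat. u k)"
    using assms(1) unfolding sym_alg_def by blast
  have "(\<Sum>k\<le>M. u k) \<in> sym_alg \<and> P (\<Sum>k\<le>M. u k)" if "M \<le> N" for M
    using that
    by (induction M) (auto intro!: add sym_alg_add intro: f(1) power sym_power_sym_alg)
  then show ?thesis
    using f(2) by simp
qed

lemma sym_alg_mult:
  assumes "f \<in> sym_alg" "g \<in> sym_alg"
  shows "f * g \<in> sym_alg"
  using assms(1)
proof (induction rule: sym_alg_induct)
  case (power k u)
  note u = this
  show ?case
    using assms(2)
  proof (induction rule: sym_alg_induct)
    case (power m v)
    then show ?case by (rule sym_power_sym_alg[OF sym_power_mult[OF u]])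
  next
    case (add v w)
    then show ?case using sym_alg_add[OF add(3,4)] by (simp only: distrib_left)
  qed
next
  case (add u v)
  then show ?case using sym_alg_add[OF add(3,4)] by (simp only: distrib_right)
qed

lemma sym_alg_diff: "\<lbrakk>f \<in> sym_alg; g \<in> sym_alg\<rbrakk> \<Longrightarrow> f - g \<in> sym_alg"
  unfolding diff_eq_add_const_mult
  by (intro sym_alg_add sym_alg_mult sym_power_sym_alg[OF sym_power_const])

text \<open>The type \<open>'g\<close> is only a real vector space, without a topology, so
  continuity is expressed along lines. It is used to fill in the value at a single missing
  parameter.\<close>

lemma sym_alg_continuous_on_line:
  assumes "f \<in> sym_alg"
  shows "continuous_on UNIV (\<lambda>t. f (x + t *\<^sub>R w))"
  using assms
proof (induction rule: sym_alg_induct)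
  case (power k f)
  then show ?case
    by (induction rule: sym_power_induct)
      (auto simp: linear_add linear_scale intro!: continuous_intros)
qed (auto intro: continuous_intros)

section \<open>Divisibility by linear forms\<close>

text \<open>Degrees are integers, so that division by a linear form of something of degree \<open>0\<close> gives \<open>0\<close>.\<close>

definition sym_degree :: "int \<Rightarrow> ('g::real_vector \<Rightarrow> real) set" where
  "sym_degree n = (if n < 0 then {0} else sym_power (nat n))"

text \<open>Moving \<open>x\<close> by \<open>- a x\<close> along \<open>v\<close> changes a linear
  form \<open>b\<close> by a multiple of \<open>a x\<close>, and the product rule carries this
  factor through all products. The quotient loses one degree; for a constant it is 0, in degree
  -1.\<close>

lemma sym_power_line_difference:
  assumes "linear a" "f \<in> sym_power k"
  shows "\<exists>g \<in> sym_degree (int k - 1). \<forall>x. f x - f (x - a x *\<^sub>R v) = a x * g x"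
  using assms(2)
proof (induction rule: sym_power_induct)
  case (add k f g)
  then obtain u w where mem: "u \<in> sym_degree (int k - 1)" "w \<in> sym_degree (int k - 1)"
    and eq: "\<And>x. f x - f (x - a x *\<^sub>R v) = a x * u x" "\<And>x. g x - g (x - a x *\<^sub>R v) = a x * w x"
    by blast
  have "u + w \<in> sym_degree (int k - 1)"
    using mem by (auto simp: sym_degree_def intro: sym_power_add split: if_splits)
  moreover have "(f + g) x - (f + g) (x - a x *\<^sub>R v) = a x * (u + w) x" for x
    unfolding plus_fun_apply distrib_left using eq[of x] by linarith
  ultimately show ?case by blast
next
  case (mult k b f)
  then obtain u where u: "u \<in> sym_degree (int k - 1)" "\<And>x. f x - f (x - a x *\<^sub>R v) = a x * u x"
    by blast
  let ?\<pi> = "\<lambda>x. x - a x *\<^sub>R v"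
  \<comment> \<open>For \<open>a v = 1\<close> this is the projection onto the kernel of
    \<open>a\<close> along \<open>v\<close>. Being linear for any \<open>v\<close>, it preserves
    degrees under precomposition.\<close>
  have \<pi>: "linear ?\<pi>"
    using assms(1) by (auto intro!: linearI simp: linear_add linear_scale algebra_simps)
  have "f \<circ> ?\<pi> \<in> sym_power k"
    using mult(2)
  proof (induction rule: sym_power_induct)
    case (mult k c f)
    then show ?case
      using sym_power_linear_mult[OF linear_compose[OF \<pi> mult(1)] mult(3)]
      by (simp add: o_def times_fun_def)
  next
    case (add k f g)
    then show ?case using sym_power_add[OF add(3,4)] by (simp add: o_def plus_fun_def)
  qed (auto simp: o_def sym_power_zero sym_power_const zero_fun_def[symmetric] simp flip: zero_fun_def)
  then have "(\<lambda>x. b v) * (f \<circ> ?\<pi>) \<in> sym_power k"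
    by (rule sym_power_scale)
  \<comment> \<open>For \<open>k = 0\<close> the quotient \<open>u\<close> has degree -1 and is
    therefore 0.\<close>
  moreover have "b * u \<in> sym_power k"
    using u(1) sym_power_linear_mult[OF mult(1), of u "k - 1"]
    by (cases k) (auto simp: sym_degree_def sym_power_zero nat_diff_distrib)
  ultimately have "b * u + (\<lambda>x. b v) * (f \<circ> ?\<pi>) \<in> sym_degree (int (Suc k) - 1)"
    by (simp add: sym_degree_def sym_power_add)
  moreover have "(b * f) x - (b * f) (?\<pi> x) = a x * (b * u + (\<lambda>x. b v) * (f \<circ> ?\<pi>)) x" for x
  proof -
    \<comment> \<open>Product rule for differences: the first difference is divisible by
      \<open>a\<close> by induction, and the second one equals \<open>a x * b v\<close>.\<close>
    have "(b * f) x - (b * f) (?\<pi> x) = b x * (f x - f (?\<pi> x)) + (b x - b (?\<pi> x)) * f (?\<pi> x)"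
      by (simp add: algebra_simps)
    then show ?thesis
      unfolding u(2) using mult(1) by (simp add: linear_diff linear_scale algebra_simps)
  qed
  ultimately show ?case by blast
qed (auto simp: sym_degree_def sym_power_zero intro!: bexI[of _ 0])

lemma sym_alg_line_difference:
  assumes "linear a" "f \<in> sym_alg"
  shows "\<exists>g \<in> sym_alg. \<forall>x. f x - f (x - a x *\<^sub>R v) = a x * g x"
  using assms(2)
proof (induction rule: sym_alg_induct)
  case (power k f)
  then obtain g where "g \<in> sym_degree (int k - 1)" "\<forall>x. f x - f (x - a x *\<^sub>R v) = a x * g x"
    using sym_power_line_difference[OF assms(1)] by blast
  then show ?case
    by (intro bexI[of _ g]) (auto simp: sym_degree_def sym_alg_zero intro: sym_power_sym_alg split: if_splits)
next
  case (add f g)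
  then obtain u w where mem: "u \<in> sym_alg" "w \<in> sym_alg"
    and eq: "\<And>x. f x - f (x - a x *\<^sub>R v) = a x * u x" "\<And>x. g x - g (x - a x *\<^sub>R v) = a x * w x"
    by blast
  have "(f + g) x - (f + g) (x - a x *\<^sub>R v) = a x * (u + w) x" for x
    unfolding plus_fun_apply distrib_left using eq[of x] by linarith
  then show ?case using sym_alg_add[OF mem] by blast
qed

text \<open>If \<alpha> \<open>j\<close> vanished on the whole kernel of \<alpha> \<open>i\<close>,
  it would be a multiple of \<alpha> \<open>i\<close>, or \<alpha> \<open>i\<close> would be zero;
  either way there is a nontrivial linear relation.\<close>

lemma indep_forms_kernel:
  assumes "linear (\<alpha> i)" "linear (\<alpha> j)" "indep_forms \<alpha> {i, j}" "i \<noteq> j"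
  obtains w where "\<alpha> i w = 0" "\<alpha> j w \<noteq> 0"
proof (rule ccontr)
  assume contr: "\<not> thesis"
  have ker: "\<alpha> j w = 0" if "\<alpha> i w = 0" for w
    using contr that \<open>\<And>w. \<lbrakk>\<alpha> i w = 0; \<alpha> j w \<noteq> 0\<rbrakk> \<Longrightarrow> thesis\<close> by blast
  have indep: "c i = 0 \<and> c j = 0" if "\<And>x. c i * \<alpha> i x + c j * \<alpha> j x = 0" for c
    using assms(3,4) that unfolding indep_forms_def by auto
  show False
  proof (cases "\<exists>v. \<alpha> i v \<noteq> 0")
    case True
    then obtain v where v: "\<alpha> i v \<noteq> 0" by blast
    have "- \<alpha> j v * \<alpha> i x + \<alpha> i v * \<alpha> j x = 0" for x
    proof -
      \<comment> \<open>This combination of \<open>x\<close> and \<open>v\<close> is chosen to lie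
        in the kernel of \<alpha> \<open>i\<close>; applying \<alpha> \<open>j\<close> to it gives
        the relation.\<close>
      have "\<alpha> i (\<alpha> i v *\<^sub>R x - \<alpha> i x *\<^sub>R v) = 0"
        using assms(1) by (simp add: linear_diff linear_scale)
      then have "\<alpha> j (\<alpha> i v *\<^sub>R x - \<alpha> i x *\<^sub>R v) = 0"
        by (rule ker)
      then show ?thesis
        using assms(2) by (simp add: linear_diff linear_scale mult.commute)
    qed
    then show False
      using indep[of "\<lambda>k. if k = j then \<alpha> i v else - \<alpha> j v"] v assms(4) by simp
  next
    case False
    then show False
      using indep[of "\<lambda>k. if k = j then 0 else 1"] assms(4) by simp
  qed
qed

section \<open>Cancelling and dividing by products of linear forms\<close>

text \<open>Since \<open>a w\<close> is nonzero, \<open>a\<close> vanishes at exactly one point of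
  the line through \<open>x\<close> in direction \<open>w\<close>. Elsewhere on the line
  \<open>h\<close> must vanish, and by continuity it vanishes at that point too.\<close>

lemma zero_on_line:
  assumes "h \<in> sym_alg" "linear a" "a w \<noteq> 0" "\<And>t. a (x + t *\<^sub>R w) * h (x + t *\<^sub>R w) = 0"
  shows "h x = 0"
proof -
  \<comment> \<open>The unique parameter at which \<open>a\<close> vanishes on the line.\<close>
  define s where "s = - a x / a w"
  have zero: "h (x + t *\<^sub>R w) = 0" if "t \<noteq> s" for t
  proof -
    have "a (x + t *\<^sub>R w) \<noteq> 0"
      using that assms(2,3) by (auto simp: s_def linear_add linear_scale field_simps eq_neg_iff_add_eq_0)
    then show ?thesis using assms(4)[of t] by simp
  qed
  have "((\<lambda>t. h (x + t *\<^sub>R w)) \<longlongrightarrow> h (x + s *\<^sub>R w)) (at s)"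
    using sym_alg_continuous_on_line[OF assms(1)] by (auto simp: continuous_on_def)
  moreover have "((\<lambda>t. h (x + t *\<^sub>R w)) \<longlongrightarrow> 0) (at s)"
    by (rule tendsto_eventually) (auto simp: eventually_at_filter zero)
  ultimately have "h (x + s *\<^sub>R w) = 0"
    by (rule tendsto_unique[OF at_neq_bot])
  \<comment> \<open>Parameter 0 is the point \<open>x\<close>; it is either \<open>s\<close>, where
    the limit was used, or one of the other parameters.\<close>
  then have "h (x + 0 *\<^sub>R w) = 0"
    using zero by metis
  then show ?thesis by simp
qed

lemma sym_power_one: "1 \<in> sym_power 0"
  unfolding one_fun_def by (rule sym_power_const)

lemma sym_power_prod:
  "(\<And>j. j \<in> A \<Longrightarrow> linear (\<alpha> j)) \<Longrightarrow> (\<Prod>j\<in>A. \<alpha> j) \<in> sym_power (card A)"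
proof (induction A rule: infinite_finite_induct)
  \<comment> \<open>For infinite \<open>A\<close> the product defaults to 1 and the cardinality to
    0, which is consistent.\<close>
  case (infinite A)
  then show ?case using sym_power_one by (metis prod.infinite card.infinite)
next
  case empty
  then show ?case by (simp only: prod.empty card.empty sym_power_one)
next
  case (insert a A)
  then show ?case
    using sym_power_linear_mult[of "\<alpha> a" "\<Prod>j\<in>A. \<alpha> j" "card A"]
    by (simp only: prod.insert[OF insert.hyps] card_insert_disjoint[OF insert.hyps] insert_iff simp_thms)
qed

text \<open>The forms are cancelled one at a time: each varies along some direction that preserves
  \<open>K\<close>, so \<open>zero_on_line\<close> applies on a line inside \<open>K\<close>. The
  set \<open>K\<close> will be a hyperplane for divisibility and the whole space for linear
  independence.\<close>

lemma prod_forms_cancel: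
  assumes "finite A" "\<And>j. j \<in> A \<Longrightarrow> linear (\<alpha> j)"
    and "\<And>j. j \<in> A \<Longrightarrow> \<exists>w. \<alpha> j w \<noteq> 0 \<and> (\<forall>x\<in>K. \<forall>t. x + t *\<^sub>R w \<in> K)"
    and "h \<in> sym_alg" "\<And>x. x \<in> K \<Longrightarrow> ((\<Prod>j\<in>A. \<alpha> j) * h) x = 0" "x \<in> K"
  shows "h x = 0"
  using assms
proof (induction A arbitrary: x rule: finite_induct)
  case (insert j A)
  obtain w where w: "\<alpha> j w \<noteq> 0" "\<And>x t. x \<in> K \<Longrightarrow> x + t *\<^sub>R w \<in> K"
    using insert.prems(2)[of j] by blast
  have "((\<Prod>j\<in>A. \<alpha> j) * h) x = 0" if "x \<in> K" for x
  proof (rule zero_on_line[where a = "\<alpha> j"])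
    show "(\<Prod>j\<in>A. \<alpha> j) * h \<in> sym_alg"
      using insert.prems(1,3) by (intro sym_alg_mult sym_power_sym_alg[OF sym_power_prod]) auto
    show "\<alpha> j (x + t *\<^sub>R w) * ((\<Prod>j\<in>A. \<alpha> j) * h) (x + t *\<^sub>R w) = 0" for t
      using insert.prems(4)[OF w(2)[OF that]] insert.hyps by (simp add: mult.assoc)
  qed (use insert.prems(1) w in auto)
  then show ?case
    using insert.IH insert.prems by blast
qed auto

text \<open>Common treatment of the graded pieces and of the whole symmetric algebra.\<close>

locale divisible_family =
  fixes T :: "int \<Rightarrow> ('g::real_vector \<Rightarrow> real) set"
  assumes subset_sym_alg: "f \<in> T n \<Longrightarrow> f \<in> sym_alg"
    and zero_mem: "0 \<in> T n"
    and diff_mem: "\<lbrakk>f \<in> T n; g \<in> T n\<rbrakk> \<Longrightarrow> f - g \<in> T n"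
    and mult_mem: "\<lbrakk>f \<in> T (n - int k); g \<in> sym_power k\<rbrakk> \<Longrightarrow> f * g \<in> T n"
    and line_difference:
      "\<lbrakk>linear a; f \<in> T n\<rbrakk> \<Longrightarrow> \<exists>g \<in> T (n - 1). \<forall>x. f x - f (x - a x *\<^sub>R v) = a x * g x"
begin

lemma linear_dvd:
  assumes "linear a" "a v \<noteq> 0" "f \<in> T n" "\<And>x. a x = 0 \<Longrightarrow> f x = 0"
  shows "\<exists>g \<in> T (n - 1). f = a * g"
proof -
  \<comment> \<open>Normalised to \<open>a v' = 1\<close>, so that
    \<open>x - a x *\<^sub>R v'\<close> lies in the kernel of \<open>a\<close>, where
    \<open>f\<close> vanishes.\<close>
  define v' where "v' = v /\<^sub>R a v"
  obtain g where g: "g \<in> T (n - 1)" "\<And>x. f x - f (x - a x *\<^sub>R v') = a x * g x"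
    using line_difference[OF assms(1,3)] by blast
  have "f (x - a x *\<^sub>R v') = 0" for x
    using assms(1,2) by (intro assms(4)) (simp add: v'_def linear_diff linear_scale)
  with g show ?thesis by (auto simp: fun_eq_iff)
qed

text \<open>Once the product over \<open>A\<close> has been split off from \<open>f\<close>, the
  cofactor \<open>h\<close> still vanishes on the kernel of the next form \<alpha> \<open>i\<close>:
  there \<open>f\<close> is zero, and by pairwise independence the other forms can be cancelled.
  Hence \<alpha> \<open>i\<close> divides \<open>h\<close>. The common vector \<open>v\<close>
  witnesses that every form is nonzero.\<close>

lemma prod_forms_dvd:
  assumes "finite A" "\<And>j. j \<in> A \<Longrightarrow> linear (\<alpha> j)" "\<And>j. j \<in> A \<Longrightarrow> \<alpha> j v \<noteq> 0"
    and "\<And>i j. \<lbrakk>i \<in> A; j \<in> A; i \<noteq> j\<rbrakk> \<Longrightarrow> indep_forms \<alpha> {i, j}"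
    and "f \<in> T n" "\<And>j x. \<lbrakk>j \<in> A; \<alpha> j x = 0\<rbrakk> \<Longrightarrow> f x = 0"
  shows "\<exists>g \<in> T (n - int (card A)). f = (\<Prod>j\<in>A. \<alpha> j) * g"
  using assms
proof (induction A rule: finite_induct)
  case (insert i A)
  then obtain h where h: "h \<in> T (n - int (card A))" "f = (\<Prod>j\<in>A. \<alpha> j) * h"
    by blast
  have "h x = 0" if "\<alpha> i x = 0" for x
  proof (rule prod_forms_cancel[where A = A and \<alpha> = \<alpha> and K = "{x. \<alpha> i x = 0}"])
    show "\<exists>w. \<alpha> j w \<noteq> 0 \<and> (\<forall>x\<in>{x. \<alpha> i x = 0}. \<forall>t. x + t *\<^sub>R w \<in> {x. \<alpha> i x = 0})" if "j \<in> A" for j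
    proof -
      \<comment> \<open>Independence provides a direction inside the kernel of \<alpha>
        \<open>i\<close> along which \<alpha> \<open>j\<close> varies.\<close>
      have "i \<noteq> j" using that insert.hyps by auto
      with that insert.prems(1,3) obtain w where "\<alpha> i w = 0" "\<alpha> j w \<noteq> 0"
        by (metis indep_forms_kernel insertI1 insertI2)
      then show ?thesis
        using insert.prems(1) by (intro exI[of _ w]) (auto simp: linear_add linear_scale)
    qed
  qed (use that insert.hyps insert.prems(1,5) h subset_sym_alg in auto)
  then obtain g where g: "g \<in> T (n - int (card A) - 1)" "h = \<alpha> i * g"
    using linear_dvd[of "\<alpha> i" v h] h(1) insert.prems(1,2) by blast
  moreover have "n - int (card A) - 1 = n - int (card (insert i A))"
    using insert.hyps by simp
  ultimately show ?case
    using h(2) insert.hyps by (intro bexI[of _ g]) (auto simp: mult_ac)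
qed (auto simp: fun_eq_iff)

end

text \<open>The graded instance, which keeps track of the degrees of quotients and leads to the
  direct sum decomposition.\<close>

interpretation sym_degree: divisible_family sym_degree
proof
  show "f \<in> sym_alg" if "f \<in> sym_degree n" for f n
    using that by (auto simp: sym_degree_def sym_alg_zero sym_power_sym_alg split: if_splits)
  show zero: "0 \<in> sym_degree n" for n
    by (simp add: sym_degree_def sym_power_zero)
  show "f - g \<in> sym_degree n" if "f \<in> sym_degree n" "g \<in> sym_degree n" for f g n
    using that by (auto simp: sym_degree_def sym_power_diff split: if_splits)
  show "f * g \<in> sym_degree n" if "f \<in> sym_degree (n - int k)" "g \<in> sym_power k" for f g n k
  proof (cases "n < int k")
    \<comment> \<open>The first factor has negative degree here, so it is 0.\<close>
    case True
    then have "f * g = 0" using that(1) by (simp add: sym_degree_def)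
    then show ?thesis using zero by metis
  next
    case False
    then have "f * g \<in> sym_power (nat (n - int k) + k)"
      using that by (intro sym_power_mult) (auto simp: sym_degree_def)
    moreover have "nat (n - int k) + k = nat n" "\<not> n < 0"
      using False by auto
    ultimately show ?thesis by (simp only: sym_degree_def if_False)
  qed
  show "\<exists>g \<in> sym_degree (n - 1). \<forall>x. f x - f (x - a x *\<^sub>R v) = a x * g x"
    if "linear a" "f \<in> sym_degree n" for a f n v
  proof (cases "n < 0")
    case True
    then have "f = 0" using that(2) by (simp add: sym_degree_def)
    then have "\<forall>x. f x - f (x - a x *\<^sub>R v) = a x * 0 x"
      by simp
    then show ?thesis using zero by (rule bexI)
  next
    case False
    then have "f \<in> sym_power (nat n)" "int (nat n) = n"
      using that(2) by (simp_all add: sym_degree_def)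
    then show ?thesis
      using sym_power_line_difference[OF that(1), of f "nat n" v] by (simp only:)
  qed
qed

text \<open>The ungraded instance: a constant family that ignores degrees and leads to the freeness
  statement.\<close>

interpretation sym_alg: divisible_family "\<lambda>_. sym_alg"
proof
  show "f * g \<in> sym_alg" if "f \<in> sym_alg" "g \<in> sym_power k"
    for f g :: "'a \<Rightarrow> real" and k
    by (rule sym_alg_mult[OF that(1) sym_power_sym_alg[OF that(2)]])
  show "\<exists>g\<in>sym_alg. \<forall>x. f x - f (x - a x *\<^sub>R v) = a x * g x" if "linear a" "f \<in> sym_alg"
    for a f and v :: 'a
    using that by (rule sym_alg_line_difference)
qed (rule sym_alg_zero sym_alg_diff | assumption)+

section \<open>The module of cohomology classes\<close>

lemma smult_coh_apply [simp]: "(s \<odot> f) p = s * f p"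
  by (simp add: smult_coh_def)

lemma zero_smult_coh [simp]: "0 \<odot> f = 0"
  by (rule ext) (simp only: smult_coh_apply mult_zero_left zero_fun_apply)

lemma diff_smult_coh: "(s - t) \<odot> f = s \<odot> f - t \<odot> f"
  by (rule ext) (simp only: smult_coh_apply left_diff_distrib minus_apply)

lemma cohomologyI:
  assumes "\<And>p. p \<in> verts G \<Longrightarrow> f p \<in> sym_alg" "\<And>p. p \<notin> verts G \<Longrightarrow> f p = 0"
    and "\<And>e. e \<in> arcs G \<Longrightarrow> \<exists>h\<in>sym_alg. f (tail G e) - f (head G e) = \<alpha> e * h"
  shows "f \<in> cohomology G \<alpha>"
  unfolding cohomology_def using assms by blast

lemma cohomology_arc:
  assumes "f \<in> cohomology G \<alpha>" "e \<in> arcs G"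
  obtains h where "h \<in> sym_alg" "f (tail G e) - f (head G e) = \<alpha> e * h"
  using assms unfolding cohomology_def by blast

lemma cohomology_sym_alg:
  assumes "f \<in> cohomology G \<alpha>"
  shows "f p \<in> sym_alg"
proof (cases "p \<in> verts G")
  case True
  then show ?thesis using assms unfolding cohomology_def by blast
next
  case False
  then have "f p = 0" using assms unfolding cohomology_def by blast
  then show ?thesis by (simp only: sym_alg_zero)
qed

lemma cohomology_outside: "\<lbrakk>f \<in> cohomology G \<alpha>; p \<notin> verts G\<rbrakk> \<Longrightarrow> f p = 0"
  unfolding cohomology_def by blast

lemma cohomology_zero: "0 \<in> cohomology G \<alpha>"
proof (rule cohomologyI)
  show "\<exists>h\<in>sym_alg. 0 (tail G e) - 0 (head G e) = \<alpha> e * h" for e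
    by (rule bexI[OF _ sym_alg_zero]) (simp only: zero_fun_apply diff_self mult_zero_right)
qed (simp_all only: zero_fun_apply sym_alg_zero)

lemma cohomology_add:
  assumes f: "f \<in> cohomology G \<alpha>" and g: "g \<in> cohomology G \<alpha>"
  shows "f + g \<in> cohomology G \<alpha>"
proof (rule cohomologyI)
  show "(f + g) p \<in> sym_alg" for p
    unfolding plus_fun_apply[of f g] by (rule sym_alg_add[OF cohomology_sym_alg[OF f] cohomology_sym_alg[OF g]])
  show "(f + g) p = 0" if "p \<notin> verts G" for p
    unfolding plus_fun_apply[of f g] cohomology_outside[OF f that] cohomology_outside[OF g that] by (rule add_0)
  show "\<exists>h\<in>sym_alg. (f + g) (tail G e) - (f + g) (head G e) = \<alpha> e * h" if e: "e \<in> arcs G" for e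
  proof -
    obtain u where u: "u \<in> sym_alg" "f (tail G e) - f (head G e) = \<alpha> e * u"
      by (rule cohomology_arc[OF f e])
    obtain w where w: "w \<in> sym_alg" "g (tail G e) - g (head G e) = \<alpha> e * w"
      by (rule cohomology_arc[OF g e])
    have "(f + g) (tail G e) - (f + g) (head G e) = \<alpha> e * (u + w)"
      unfolding plus_fun_apply[of f g] add_diff_add u(2) w(2) distrib_left ..
    then show ?thesis using sym_alg_add[OF u(1) w(1)] by (rule bexI)
  qed
qed

lemma cohomology_smult:
  assumes s: "s \<in> sym_alg" and f: "f \<in> cohomology G \<alpha>"
  shows "s \<odot> f \<in> cohomology G \<alpha>"
proof (rule cohomologyI)
  show "(s \<odot> f) p \<in> sym_alg" for p
    unfolding smult_coh_apply by (rule sym_alg_mult[OF s cohomology_sym_alg[OF f]])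
  show "(s \<odot> f) p = 0" if "p \<notin> verts G" for p
    unfolding smult_coh_apply cohomology_outside[OF f that] by (rule mult_zero_right)
  show "\<exists>h\<in>sym_alg. (s \<odot> f) (tail G e) - (s \<odot> f) (head G e) = \<alpha> e * h" if e: "e \<in> arcs G" for e
  proof -
    obtain u where u: "u \<in> sym_alg" "f (tail G e) - f (head G e) = \<alpha> e * u"
      by (rule cohomology_arc[OF f e])
    have "(s \<odot> f) (tail G e) - (s \<odot> f) (head G e) = \<alpha> e * (s * u)"
      unfolding smult_coh_apply right_diff_distrib[symmetric] u(2) by (rule mult.left_commute)
    then show ?thesis using sym_alg_mult[OF s u(1)] by (rule bexI)
  qed
qed

lemma cohomology_diff:
  assumes "f \<in> cohomology G \<alpha>" "g \<in> cohomology G \<alpha>"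
  shows "f - g \<in> cohomology G \<alpha>"
proof -
  have "f - g = f + (\<lambda>x. - 1) \<odot> g"
  proof
    show "(f - g) p = (f + (\<lambda>x. - 1) \<odot> g) p" for p
      unfolding minus_apply[of f g] plus_fun_apply[of f] smult_coh_apply by (rule diff_eq_add_const_mult)
  qed
  then show ?thesis
    using cohomology_add[OF assms(1) cohomology_smult[OF sym_power_sym_alg[OF sym_power_const] assms(2)]]
    by metis
qed

text \<open>Serves both the cohomology ring and its graded pieces. An infinite index set gives the
  sum 0, which lies in \<open>M\<close> as well.\<close>

lemma sum_mem_of_add_closed:
  assumes "0 \<in> M" "\<And>f g. \<lbrakk>f \<in> M; g \<in> M\<rbrakk> \<Longrightarrow> f + g \<in> M" "\<And>i. i \<in> I \<Longrightarrow> u i \<in> M"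
  shows "(\<Sum>i\<in>I. u i) \<in> M"
  using assms(3)
proof (induction I rule: infinite_finite_induct)
  case (insert i I)
  then show ?case
    unfolding sum.insert[OF insert.hyps] by (intro assms(2)) auto
qed (simp_all only: sum.infinite sum.empty assms(1) simp_thms)

lemma cohomology_sum:
  assumes "\<And>i. i \<in> I \<Longrightarrow> u i \<in> cohomology G \<alpha>"
  shows "(\<Sum>i\<in>I. u i) \<in> cohomology G \<alpha>"
proof (rule sum_mem_of_add_closed)
  show "f + g \<in> cohomology G \<alpha>" if "f \<in> cohomology G \<alpha>" "g \<in> cohomology G \<alpha>" for f g
    using that by (rule cohomology_add)
qed (rule cohomology_zero, rule assms)

lemma cohomology_degI:
  assumes "f \<in> cohomology G \<alpha>" "\<And>p. p \<in> verts G \<Longrightarrow> f p \<in> sym_power m"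
  shows "f \<in> cohomology_deg G \<alpha> m"
  unfolding cohomology_deg_def using assms by blast

lemma cohomology_degD:
  assumes "f \<in> cohomology_deg G \<alpha> m"
  shows "f \<in> cohomology G \<alpha>" and "p \<in> verts G \<Longrightarrow> f p \<in> sym_power m"
  using assms unfolding cohomology_deg_def by blast+

lemma cohomology_deg_sum:
  assumes "\<And>i. i \<in> I \<Longrightarrow> u i \<in> cohomology_deg G \<alpha> m"
  shows "(\<Sum>i\<in>I. u i) \<in> cohomology_deg G \<alpha> m"
proof (rule sum_mem_of_add_closed)
  show "0 \<in> cohomology_deg G \<alpha> m"
  proof (rule cohomology_degI[OF cohomology_zero])
    show "0 p \<in> sym_power m" for p
      by (subst zero_fun_apply) (rule sym_power_zero)
  qed
  show "f + g \<in> cohomology_deg G \<alpha> m"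
    if f: "f \<in> cohomology_deg G \<alpha> m" and g: "g \<in> cohomology_deg G \<alpha> m" for f g
  proof (rule cohomology_degI)
    show "f + g \<in> cohomology G \<alpha>"
      by (rule cohomology_add[OF cohomology_degD(1)[OF f] cohomology_degD(1)[OF g]])
    show "(f + g) p \<in> sym_power m" if "p \<in> verts G" for p
      by (subst plus_fun_apply)
        (rule sym_power_add[OF cohomology_degD(2)[OF f that] cohomology_degD(2)[OF g that]])
  qed
qed (rule assms)

section \<open>Classes supported on flow-outs\<close>

text \<open>The compatible function is fixed as a parameter since it is the height by which vertices
  are ordered, both for spanning and for independence.\<close>

locale flow_generators = one_skeleton G arev \<theta> \<alpha> d
  for G :: "('v, 'e) pre_digraph" (structure) and arev \<theta>
    and \<alpha> :: "'e \<Rightarrow> 'g::real_vector \<Rightarrow> real" and d +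
  fixes \<xi> :: 'g and \<phi> :: "'v \<Rightarrow> real" and \<tau> :: "'v \<Rightarrow> 'v \<Rightarrow> 'g \<Rightarrow> real"
  assumes polarizing: "\<xi> \<in> polarizing G \<alpha>"
    and compatible: "compatible_function G \<alpha> \<xi> \<phi>"
    and generator_deg: "p \<in> verts G \<Longrightarrow> \<tau> p \<in> cohomology_deg G \<alpha> (vertex_index G \<alpha> \<xi> p)"
    and generator_support: "\<lbrakk>p \<in> verts G; q \<in> verts G; q \<notin> flow_out G \<alpha> \<xi> p\<rbrakk> \<Longrightarrow> \<tau> p q = 0"
    and generator_self: "p \<in> verts G \<Longrightarrow> \<tau> p p = (\<Prod>e\<in>descending_arcs G \<alpha> \<xi> p. \<alpha> e)"
begin

section \<open>Behaviour of the height \<phi> along flow-outs and descending arcs\<close>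

text \<open>Every ascending arc strictly raises \<phi>, so only the trivial path returns to the
  height of \<open>p\<close>. This makes the generators triangular.\<close>

lemma flow_out_less:
  assumes "q \<in> flow_out G \<alpha> \<xi> p"
  shows "q = p \<or> \<phi> p < \<phi> q"
proof -
  have "(p, q) \<in> rtrancl_on (verts G) (arcs_ends (ascending_graph G \<alpha> \<xi>))"
    using assms by (simp add: flow_out_def reachable_def ascending_graph_def)
  then show ?thesis
  proof (induction rule: rtrancl_on_induct)
    case (step y z)
    then have "\<phi> y < \<phi> z"
      using compatible
      by (auto simp: compatible_function_def arcs_ends_def arc_to_ends_def ascending_graph_def)
    with step.IH show ?case by auto
  qed auto
qed

lemma flow_out_verts:
  assumes "q \<in> flow_out G \<alpha> \<xi> p"
  shows "q \<in> verts G"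
proof -
  have "p \<rightarrow>\<^sup>*\<^bsub>ascending_graph G \<alpha> \<xi>\<^esub> q"
    using assms by (simp add: flow_out_def)
  then have "q \<in> verts (ascending_graph G \<alpha> \<xi>)"
    by (rule reachable_in_vertsE)
  then show ?thesis by (simp add: ascending_graph_def)
qed

lemma generator_cohomology: "p \<in> verts G \<Longrightarrow> \<tau> p \<in> cohomology G \<alpha>"
  by (rule cohomology_degD(1)[OF generator_deg])

lemma generator_sym_power:
  "\<lbrakk>p \<in> verts G; q \<in> verts G\<rbrakk> \<Longrightarrow> \<tau> p q \<in> sym_power (vertex_index G \<alpha> \<xi> p)"
  by (rule cohomology_degD(2)[OF generator_deg])

text \<open>Extends the support condition to all \<open>q\<close>, since classes vanish outside the
  vertex set by convention.\<close>

lemma generator_eq_zero: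
  assumes "p \<in> verts G" "q \<notin> flow_out G \<alpha> \<xi> p"
  shows "\<tau> p q = 0"
proof (cases "q \<in> verts G")
  case True
  then show ?thesis by (rule generator_support[OF assms(1) _ assms(2)])
next
  case False
  then show ?thesis by (rule cohomology_outside[OF generator_cohomology[OF assms(1)]])
qed

text \<open>The reversed arc has a positive value at \<xi> and runs from the head of
  \<open>e\<close> back to \<open>p\<close>, so \<phi> increases along it.\<close>

lemma descending_arc_less:
  assumes "e \<in> descending_arcs G \<alpha> \<xi> p"
  shows "\<phi> (head G e) < \<phi> p"
proof -
  have e: "e \<in> arcs G" "tail G e = p" "\<alpha> e \<xi> < 0"
    using assms by (auto simp: descending_arcs_def)
  obtain m m' :: real where m: "m > 0" "m' > 0" "m' * \<alpha> (arev e) \<xi> = - m * \<alpha> e \<xi>"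
    using axial_arev[OF e(1)] by blast
  have "m' * \<alpha> (arev e) \<xi> > 0"
    unfolding m(3) using e(3) m(1) by (simp add: mult_pos_neg)
  with m(2) have "\<alpha> (arev e) \<xi> > 0"
    by (simp add: zero_less_mult_iff)
  then have "\<phi> (tail G (arev e)) < \<phi> (head G (arev e))"
    using compatible arev_in_arcs[OF e(1)] unfolding compatible_function_def by blast
  then show ?thesis using e(1,2) by simp
qed

lemma finite_descending: "finite (descending_arcs G \<alpha> \<xi> p)"
  unfolding descending_arcs_def by (rule finite_subset[OF _ finite_out_arcs[of p]]) blast

lemma descending_linear: "e \<in> descending_arcs G \<alpha> \<xi> p \<Longrightarrow> linear (\<alpha> e)"
  by (auto simp: descending_arcs_def axial_linear)

section \<open>Spanning and independence of the generators\<close>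

text \<open>An arbitrary \<open>A\<close> closed under flow-outs is allowed so that the induction on
  \<open>card A\<close> can remove a vertex of least height. The lemma is later applied to the full
  vertex set, once for each instance of \<open>T\<close>.\<close>

lemma generators_span:
  assumes "divisible_family T" "A \<subseteq> verts G"
    and "\<And>p q. \<lbrakk>p \<in> A; q \<in> flow_out G \<alpha> \<xi> p\<rbrakk> \<Longrightarrow> q \<in> A"
    and "f \<in> cohomology G \<alpha>" "\<And>p. f p \<in> T n" "\<And>p. p \<notin> A \<Longrightarrow> f p = 0"
  shows "\<exists>h. (\<forall>p\<in>A. h p \<in> T (n - int (vertex_index G \<alpha> \<xi> p))) \<and> f = (\<Sum>p\<in>A. h p \<odot> \<tau> p)"
  using assms(2-)
proof (induction "card A" arbitrary: A f)
  case 0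
  then have "A = {}" using finite_verts finite_subset by fastforce
  then show ?case using 0 by (auto simp: fun_eq_iff)
next
  case (Suc k)
  interpret divisible_family T by fact
  have "finite A" using Suc.prems(1) finite_verts finite_subset by blast
  moreover have "A \<noteq> {}" using Suc.hyps(2) by auto
  ultimately obtain p where p: "p \<in> A" "\<And>q. q \<in> A \<Longrightarrow> \<phi> p \<le> \<phi> q"
    using ex_is_arg_min_if_finite[of A \<phi>] unfolding is_arg_min_linorder by blast
  then have pV: "p \<in> verts G" using Suc.prems(1) by auto
  let ?D = "descending_arcs G \<alpha> \<xi> p"
  have "\<exists>h \<in> T (n - int (card ?D)). f p = (\<Prod>e\<in>?D. \<alpha> e) * h"
  proof (rule prod_forms_dvd[where v = \<xi>])
    show "\<alpha> e \<xi> \<noteq> 0" if "e \<in> ?D" for e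
      using that by (simp add: descending_arcs_def)
    show "indep_forms \<alpha> {i, j}" if "i \<in> ?D" "j \<in> ?D" "i \<noteq> j" for i j
      using that axial_indep[OF pV] by (auto simp: descending_arcs_def)
    show "f p x = 0" if "e \<in> ?D" "\<alpha> e x = 0" for e x
    proof -
      have e: "e \<in> arcs G" "tail G e = p"
        using that by (auto simp: descending_arcs_def)
      \<comment> \<open>The head lies strictly below \<open>p\<close>, which is lowest in
        \<open>A\<close>.\<close>
      have "head G e \<notin> A"
        using p(2) descending_arc_less[OF that(1)] by fastforce
      then have "f (head G e) = 0"
        by (rule Suc.prems(5))
      moreover obtain u where "f (tail G e) - f (head G e) = \<alpha> e * u"
        by (rule cohomology_arc[OF Suc.prems(3) e(1)])
      ultimately have "f p = \<alpha> e * u"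
        unfolding e(2) by (simp only: diff_0_right)
      then show ?thesis using that(2) by simp
    qed
  qed (use finite_descending descending_linear Suc.prems(4) in auto)
  \<comment> \<open>This \<open>h\<close> is the coefficient of \<tau> \<open>p\<close>: subtracting
    \<open>h\<close> \<odot> \<tau> \<open>p\<close> from \<open>f\<close> removes the value at
    \<open>p\<close>.\<close>
  then obtain h where h: "h \<in> T (n - int (vertex_index G \<alpha> \<xi> p))" "f p = h * \<tau> p p"
    unfolding vertex_index_def generator_self[OF pV] mult.commute[of _ "prod \<alpha> ?D"] by blast
  note \<tau> = generator_cohomology[OF pV]
  let ?f = "f - h \<odot> \<tau> p"
  have "\<exists>h'. (\<forall>q\<in>A - {p}. h' q \<in> T (n - int (vertex_index G \<alpha> \<xi> q))) \<and> ?f = (\<Sum>q\<in>A - {p}. h' q \<odot> \<tau> q)"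
  proof (rule Suc.hyps(1))
    show "k = card (A - {p})"
      using Suc.hyps(2) \<open>finite A\<close> p(1) by simp
    \<comment> \<open>A flow starting at \<open>r\<close> cannot reach \<open>p\<close>: it either
      stays at \<open>r\<close> or ends strictly above \<open>r\<close>, which is at least as high
      as \<open>p\<close>.\<close>
    show "q \<in> A - {p}" if "r \<in> A - {p}" "q \<in> flow_out G \<alpha> \<xi> r" for q r
      using that Suc.prems(2)[of r q] p(2)[of r] flow_out_less[of q r] by auto
    show "?f \<in> cohomology G \<alpha>"
      by (rule cohomology_diff[OF Suc.prems(3) cohomology_smult[OF subset_sym_alg[OF h(1)] \<tau>]])
    have f_apply: "?f q = f q - h * \<tau> p q" for q
      unfolding minus_apply[of f] smult_coh_apply ..
    have zero: "h * \<tau> p q = 0" if "q \<notin> flow_out G \<alpha> \<xi> p" for q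
      unfolding generator_eq_zero[OF pV that] by (rule mult_zero_right)
    show "?f q \<in> T n" for q
    proof -
      \<comment> \<open>On the flow-out, \<open>q\<close> is a vertex and the degrees of the two
        factors add up; off the flow-out the product is 0.\<close>
      have "h * \<tau> p q \<in> T n"
      proof (cases "q \<in> flow_out G \<alpha> \<xi> p")
        case True
        then show ?thesis by (intro mult_mem[OF h(1)] generator_sym_power[OF pV] flow_out_verts)
      next
        case False
        show ?thesis unfolding zero[OF False] by (rule zero_mem)
      qed
      then show ?thesis
        unfolding f_apply by (rule diff_mem[OF Suc.prems(4)])
    qed
    show "?f q = 0" if "q \<notin> A - {p}" for q
    proof (cases "q = p")
      case True
      show ?thesis
        unfolding f_apply True h(2)[symmetric] by (rule diff_self)
    next
      case False
      then have "q \<notin> A" using that by blast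
      then have "q \<notin> flow_out G \<alpha> \<xi> p"
        using Suc.prems(2)[OF p(1)] by blast
      then show ?thesis
        unfolding f_apply Suc.prems(5)[OF \<open>q \<notin> A\<close>] by (subst zero) (assumption, rule diff_self)
    qed
  qed (use Suc.prems(1) in auto)
  then obtain h' where h': "\<And>q. q \<in> A - {p} \<Longrightarrow> h' q \<in> T (n - int (vertex_index G \<alpha> \<xi> q))"
    "?f = (\<Sum>q\<in>A - {p}. h' q \<odot> \<tau> q)"
    by blast
  have "f = h \<odot> \<tau> p + ?f" by (simp only: add_diff_cancel_left' add_diff_eq)
  also have "\<dots> = h \<odot> \<tau> p + (\<Sum>q\<in>A - {p}. (h'(p := h)) q \<odot> \<tau> q)"
    unfolding h'(2) by (intro arg_cong2[of _ _ _ _ "(+)"] sum.cong) auto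
  also have "\<dots> = (\<Sum>q\<in>A. (h'(p := h)) q \<odot> \<tau> q)"
    using sum.remove[OF \<open>finite A\<close> p(1), of "\<lambda>q. (h'(p := h)) q \<odot> \<tau> q"] by (simp only: fun_upd_same)
  finally show ?case
    using h(1) h'(1) by (intro exI[of _ "h'(p := h)"]) auto
qed

text \<open>At a lowest vertex \<open>q\<close> among those with nonzero coefficient, only \<tau>
  \<open>q\<close> contributes to the sum. Its value there is a product of nonzero linear forms,
  which can be cancelled.\<close>

lemma generators_independent:
  assumes "A \<subseteq> verts G" "\<And>p. p \<in> A \<Longrightarrow> h p \<in> sym_alg" "(\<Sum>p\<in>A. h p \<odot> \<tau> p) = 0" "p \<in> A"
  shows "h p = 0"
proof (rule ccontr)
  let ?S = "{q \<in> A. h q \<noteq> 0}"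
  assume "h p \<noteq> 0"
  then have "?S \<noteq> {}" using assms(4) by auto
  have "finite A" using assms(1) finite_verts finite_subset by blast
  then have "finite ?S" by simp
  with \<open>?S \<noteq> {}\<close> obtain q where q: "q \<in> ?S" "\<And>r. r \<in> ?S \<Longrightarrow> \<phi> q \<le> \<phi> r"
    using ex_is_arg_min_if_finite[of ?S \<phi>] unfolding is_arg_min_linorder by blast
  \<comment> \<open>If \<open>h r\<close> is nonzero, then \<open>r\<close> is at least as high as
    \<open>q\<close>, so no flow from \<open>r\<close> reaches the different vertex
    \<open>q\<close>.\<close>
  have "h r * \<tau> r q = 0" if "r \<in> A - {q}" for r
  proof (cases "h r = 0")
    case False
    then have "q \<notin> flow_out G \<alpha> \<xi> r"
      using that q(2)[of r] flow_out_less[of q r] by auto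
    with that assms(1) have "\<tau> r q = 0"
      by (intro generator_eq_zero) blast+
    then show ?thesis by (simp only: mult_zero_right)
  next
    case True
    then show ?thesis by (simp only: mult_zero_left)
  qed
  then have rest: "(\<Sum>r\<in>A - {q}. h r * \<tau> r q) = 0"
    by (rule sum.neutral[OF ballI])
  have qA: "q \<in> A" using q(1) by blast
  have "0 = (\<Sum>r\<in>A. h r \<odot> \<tau> r) q"
    unfolding assms(3) by (simp only: zero_fun_apply)
  also have "\<dots> = (\<Sum>r\<in>A. h r * \<tau> r q)"
    unfolding sum_fun_apply[of "\<lambda>r. h r \<odot> \<tau> r"] smult_coh_apply ..
  also have "\<dots> = h q * \<tau> q q"
    unfolding sum.remove[OF \<open>finite A\<close> qA] rest by (rule add_0_right)
  also have "\<dots> = (\<Prod>e\<in>descending_arcs G \<alpha> \<xi> q. \<alpha> e) * h q"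
    using generator_self[of q] qA assms(1) by (metis mult.commute subsetD)
  finally have zero: "(\<Prod>e\<in>descending_arcs G \<alpha> \<xi> q. \<alpha> e) * h q = 0" ..
  have "h q x = 0" for x
  \<comment> \<open>On the whole space every direction is admissible, and \<xi> works for all
    descending arcs at once.\<close>
  proof (rule prod_forms_cancel[where A = "descending_arcs G \<alpha> \<xi> q" and \<alpha> = \<alpha> and K = UNIV])
    show "\<exists>w. \<alpha> e w \<noteq> 0 \<and> (\<forall>x\<in>UNIV. \<forall>t. x + t *\<^sub>R w \<in> UNIV)"
      if "e \<in> descending_arcs G \<alpha> \<xi> q" for e
      using that by (intro exI[of _ \<xi>]) (auto simp: descending_arcs_def)
    show "((\<Prod>e\<in>descending_arcs G \<alpha> \<xi> q. \<alpha> e) * h q) x = 0" for x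
      by (simp only: zero zero_fun_apply)
  qed (use finite_descending descending_linear q(1) assms(2) in auto)
  then have "h q = 0" by (simp add: fun_eq_iff)
  with q(1) show False by simp
qed

lemma generators_unique:
  assumes "A \<subseteq> verts G" "\<And>p. p \<in> A \<Longrightarrow> h p \<in> sym_alg" "\<And>p. p \<in> A \<Longrightarrow> h' p \<in> sym_alg"
    and "(\<Sum>p\<in>A. h p \<odot> \<tau> p) = (\<Sum>p\<in>A. h' p \<odot> \<tau> p)" "p \<in> A"
  shows "h p = h' p"
proof -
  have "(\<Sum>p\<in>A. (h p - h' p) \<odot> \<tau> p) = 0"
    unfolding diff_smult_coh sum_subtractf assms(4) by (rule diff_self)
  then have "h p - h' p = 0"
    using assms(2,3,5) by (intro generators_independent[OF assms(1)] sym_alg_diff)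
  then show ?thesis by (simp only: right_minus_eq)
qed

section \<open>The direct sum decomposition and freeness\<close>

lemma direct_sum:
  "is_direct_sum (cohomology_deg G \<alpha> m) {p \<in> verts G. vertex_index G \<alpha> \<xi> p \<le> m}
     (\<lambda>p. {h \<odot> \<tau> p | h. h \<in> sym_power (m - vertex_index G \<alpha> \<xi> p)})"
  (is "is_direct_sum ?M ?I ?W")
  unfolding is_direct_sum_def bij_betw_def
proof (intro conjI)
  show "finite ?I" using finite_verts by simp
  show "inj_on (\<lambda>u. \<Sum>p\<in>?I. u p) (\<Pi>\<^sub>E p\<in>?I. ?W p)"
  proof (rule inj_onI)
    fix u u'
    assume u: "u \<in> (\<Pi>\<^sub>E p\<in>?I. ?W p)" and u': "u' \<in> (\<Pi>\<^sub>E p\<in>?I. ?W p)"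
      and eq: "(\<Sum>p\<in>?I. u p) = (\<Sum>p\<in>?I. u' p)"
    \<comment> \<open>Coefficients are chosen for the summands, so that equality of sums can be
      reduced to uniqueness of coefficients.\<close>
    have rep: "\<exists>h. \<forall>p\<in>?I. h p \<in> sym_alg \<and> w p = h p \<odot> \<tau> p" if "w \<in> (\<Pi>\<^sub>E p\<in>?I. ?W p)" for w
    proof (rule bchoice, rule ballI)
      fix p assume "p \<in> ?I"
      then have "w p \<in> ?W p" by (rule PiE_mem[OF that])
      then show "\<exists>h. h \<in> sym_alg \<and> w p = h \<odot> \<tau> p"
        using sym_power_sym_alg by blast
    qed
    obtain h where h: "\<And>p. p \<in> ?I \<Longrightarrow> h p \<in> sym_alg" "\<And>p. p \<in> ?I \<Longrightarrow> u p = h p \<odot> \<tau> p"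
      using rep[OF u] by blast
    obtain h' where h': "\<And>p. p \<in> ?I \<Longrightarrow> h' p \<in> sym_alg" "\<And>p. p \<in> ?I \<Longrightarrow> u' p = h' p \<odot> \<tau> p"
      using rep[OF u'] by blast
    have eq': "(\<Sum>p\<in>?I. h p \<odot> \<tau> p) = (\<Sum>p\<in>?I. h' p \<odot> \<tau> p)"
    proof -
      have "(\<Sum>p\<in>?I. h p \<odot> \<tau> p) = (\<Sum>p\<in>?I. u p)"
        by (rule sum.cong[OF refl h(2)[symmetric]])
      also have "\<dots> = (\<Sum>p\<in>?I. h' p \<odot> \<tau> p)"
        unfolding eq by (rule sum.cong[OF refl h'(2)])
      finally show ?thesis .
    qed
    have sub: "?I \<subseteq> verts G" by blast
    show "u = u'"
    proof (rule PiE_ext[OF u u'])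
      fix p assume p: "p \<in> ?I"
      have "h p = h' p"
        by (rule generators_unique[OF sub h(1) h'(1) eq' p])
      then show "u p = u' p"
        by (simp only: h(2)[OF p] h'(2)[OF p])
    qed
  qed
  show "(\<lambda>u. \<Sum>p\<in>?I. u p) ` (\<Pi>\<^sub>E p\<in>?I. ?W p) = ?M"
  proof (intro equalityI subsetI)
    fix f
    assume "f \<in> (\<lambda>u. \<Sum>p\<in>?I. u p) ` (\<Pi>\<^sub>E p\<in>?I. ?W p)"
    then obtain u where u: "u \<in> (\<Pi>\<^sub>E p\<in>?I. ?W p)" "f = (\<Sum>p\<in>?I. u p)" by blast
    have "u p \<in> ?M" if pI: "p \<in> ?I" for p
    proof -
      obtain h where h: "h \<in> sym_power (m - vertex_index G \<alpha> \<xi> p)" "u p = h \<odot> \<tau> p"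
        using PiE_mem[OF u(1) pI] by blast
      \<comment> \<open>The natural subtraction is exact because the index of \<open>p\<close> is at
        most \<open>m\<close>.\<close>
      have p: "p \<in> verts G" "m - vertex_index G \<alpha> \<xi> p + vertex_index G \<alpha> \<xi> p = m"
        using pI by auto
      show ?thesis
        unfolding h(2)
      proof (rule cohomology_degI)
        show "h \<odot> \<tau> p \<in> cohomology G \<alpha>"
          by (rule cohomology_smult[OF sym_power_sym_alg[OF h(1)] generator_cohomology[OF p(1)]])
        show "(h \<odot> \<tau> p) q \<in> sym_power m" if "q \<in> verts G" for q
          using sym_power_mult[OF h(1) generator_sym_power[OF p(1) that]]
          unfolding p(2) smult_coh_apply .
      qed
    qed
    then show "f \<in> ?M" unfolding u(2) by (rule cohomology_deg_sum)
  next
    fix f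
    assume f: "f \<in> ?M"
    then have f': "f \<in> cohomology G \<alpha>" by (rule cohomology_degD)
    have deg: "f p \<in> sym_degree (int m)" for p
    proof (cases "p \<in> verts G")
      case True
      then have "f p \<in> sym_power m" by (rule cohomology_degD(2)[OF f])
      then show ?thesis by (simp add: sym_degree_def)
    next
      case False
      then have "f p = 0" by (rule cohomology_outside[OF f'])
      then show ?thesis by (simp only: sym_degree.zero_mem)
    qed
    have "\<exists>h. (\<forall>p\<in>verts G. h p \<in> sym_degree (int m - int (vertex_index G \<alpha> \<xi> p))) \<and>
        f = (\<Sum>p\<in>verts G. h p \<odot> \<tau> p)"
      by (rule generators_span[OF sym_degree.divisible_family_axioms subset_refl flow_out_verts f' deg
            cohomology_outside[OF f']])
    then obtain h where h: "\<And>p. p \<in> verts G \<Longrightarrow> h p \<in> sym_degree (int m - int (vertex_index G \<alpha> \<xi> p))"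
      "f = (\<Sum>p\<in>verts G. h p \<odot> \<tau> p)"
      by blast
    \<comment> \<open>Restriction makes the family extensional, as the product set requires.\<close>
    define u where "u = restrict (\<lambda>p. h p \<odot> \<tau> p) ?I"
    \<comment> \<open>A vertex of index greater than \<open>m\<close> has its coefficient in
      negative degree, so it drops out of the sum.\<close>
    have "h p = 0" if "p \<in> verts G - ?I" for p
      using h(1)[of p] that by (auto simp: sym_degree_def split: if_splits)
    then have "\<forall>p\<in>verts G - ?I. h p \<odot> \<tau> p = 0"
      by (intro ballI) (simp only: zero_smult_coh)
    then have "f = (\<Sum>p\<in>?I. h p \<odot> \<tau> p)"
      unfolding h(2) by (intro sum.mono_neutral_right[OF finite_verts]) blast+
    also have "\<dots> = (\<Sum>p\<in>?I. u p)"
      by (rule sum.cong[OF refl]) (simp only: u_def restrict_apply' )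
    finally have "f = (\<Sum>p\<in>?I. u p)" .
    moreover have "u \<in> (\<Pi>\<^sub>E p\<in>?I. ?W p)"
    proof -
      have "h p \<in> sym_power (m - vertex_index G \<alpha> \<xi> p)" if "p \<in> ?I" for p
        using h(1)[of p] that by (auto simp: sym_degree_def nat_diff_distrib)
      then show ?thesis
        unfolding u_def by (intro restrict_PiE_iff[THEN iffD2] ballI) blast
    qed
    ultimately show "f \<in> (\<lambda>u. \<Sum>p\<in>?I. u p) ` (\<Pi>\<^sub>E p\<in>?I. ?W p)" by blast
  qed
qed

lemma free_module: "is_free_module sym_alg (cohomology G \<alpha>) (verts G) \<tau>"
  unfolding is_free_module_def bij_betw_def
proof (intro conjI ballI)
  show gen: "\<tau> p \<in> cohomology G \<alpha>" if "p \<in> verts G" for p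
    using that by (rule generator_cohomology)
  show "inj_on (\<lambda>h. \<Sum>p\<in>verts G. h p \<odot> \<tau> p) (verts G \<rightarrow>\<^sub>E sym_alg)"
  proof (rule inj_onI)
    fix h h'
    assume h: "h \<in> verts G \<rightarrow>\<^sub>E sym_alg" and h': "h' \<in> verts G \<rightarrow>\<^sub>E sym_alg"
      and eq: "(\<Sum>p\<in>verts G. h p \<odot> \<tau> p) = (\<Sum>p\<in>verts G. h' p \<odot> \<tau> p)"
    show "h = h'"
      by (rule PiE_ext[OF h h'])
        (rule generators_unique[OF subset_refl PiE_mem[OF h] PiE_mem[OF h'] eq])
  qed
  show "(\<lambda>h. \<Sum>p\<in>verts G. h p \<odot> \<tau> p) ` (verts G \<rightarrow>\<^sub>E sym_alg) = cohomology G \<alpha>"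
  proof (intro equalityI subsetI)
    fix f
    assume "f \<in> (\<lambda>h. \<Sum>p\<in>verts G. h p \<odot> \<tau> p) ` (verts G \<rightarrow>\<^sub>E sym_alg)"
    then obtain h where h: "h \<in> verts G \<rightarrow>\<^sub>E sym_alg" "f = (\<Sum>p\<in>verts G. h p \<odot> \<tau> p)"
      by blast
    show "f \<in> cohomology G \<alpha>"
      unfolding h(2) by (rule cohomology_sum[OF cohomology_smult[OF PiE_mem[OF h(1)] gen]])
  next
    fix f
    assume f: "f \<in> cohomology G \<alpha>"
    have "\<exists>h. (\<forall>p\<in>verts G. h p \<in> sym_alg) \<and> f = (\<Sum>p\<in>verts G. h p \<odot> \<tau> p)"
      by (rule generators_span[OF sym_alg.divisible_family_axioms subset_refl flow_out_verts f
            cohomology_sym_alg[OF f] cohomology_outside[OF f]])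
    then obtain h where h: "\<And>p. p \<in> verts G \<Longrightarrow> h p \<in> sym_alg" "f = (\<Sum>p\<in>verts G. h p \<odot> \<tau> p)"
      by blast
    show "f \<in> (\<lambda>h. \<Sum>p\<in>verts G. h p \<odot> \<tau> p) ` (verts G \<rightarrow>\<^sub>E sym_alg)"
    proof (rule image_eqI)
      show "restrict h (verts G) \<in> verts G \<rightarrow>\<^sub>E sym_alg"
        using h(1) by (intro restrict_PiE_iff[THEN iffD2] ballI)
      show "f = (\<Sum>p\<in>verts G. restrict h (verts G) p \<odot> \<tau> p)"
        unfolding h(2) by (rule sum.cong[OF refl]) (simp only: restrict_apply')
    qed
  qed
qed (assumption | rule finite_verts cohomology_zero cohomology_add cohomology_smult)+

end

theorem theorem2p4p4:
  fixes G :: "('v, 'e) pre_digraph"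
    and arev :: "'e \<Rightarrow> 'e"
    and \<theta> :: "'e \<Rightarrow> 'e \<Rightarrow> 'e"
    and \<alpha> :: "'e \<Rightarrow> 'g::real_vector \<Rightarrow> real"
    and d :: nat
    and \<xi> :: 'g
    and \<tau> :: "'v \<Rightarrow> 'v \<Rightarrow> 'g \<Rightarrow> real"
  defines "\<sigma> \<equiv> vertex_index G \<alpha> \<xi>"
  assumes "one_skeleton G arev \<theta> \<alpha> d"
    and "three_independent G \<alpha>"
    and "non_cyclic G \<alpha>"
    and "\<xi> \<in> polarizing G \<alpha>"
    and "\<exists>\<phi> :: 'v \<Rightarrow> real. compatible_function G \<alpha> \<xi> \<phi>"
    and "\<And>p. p \<in> verts G \<Longrightarrow> \<tau> p \<in> cohomology_deg G \<alpha> (\<sigma> p)"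
    and "\<And>p q. \<lbrakk>p \<in> verts G; q \<in> verts G; q \<notin> flow_out G \<alpha> \<xi> p\<rbrakk> \<Longrightarrow> \<tau> p q = 0"
    and "\<And>p. p \<in> verts G \<Longrightarrow> \<tau> p p = (\<Prod>e\<in>descending_arcs G \<alpha> \<xi> p. \<alpha> e)"
  shows "(\<forall>m. is_direct_sum (cohomology_deg G \<alpha> m) {p \<in> verts G. \<sigma> p \<le> m}
                (\<lambda>p. {h \<odot> \<tau> p | h. h \<in> sym_power (m - \<sigma> p)})) \<and>
         is_free_module sym_alg (cohomology G \<alpha>) (verts G) \<tau>"
proof -
  obtain \<phi> :: "'v \<Rightarrow> real" where \<phi>: "compatible_function G \<alpha> \<xi> \<phi>"
    using assms(6) by blast
  interpret one_skeleton G arev \<theta> \<alpha> d by fact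
  interpret flow_generators G arev \<theta> \<alpha> d \<xi> \<phi> \<tau>
    by unfold_locales (use assms \<phi> in auto)
  show ?thesis
    unfolding \<sigma>_def using direct_sum free_module by blast
qed

end
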